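(* Let $r\ge1$ and $n>r$ be integers, let $E_j=[\alpha_j,\beta_j]\subseteq[0,2\pi)$, $j=1,\dots,r$, be pairwise disjoint intervals of equal length $\Delta=\beta_j-\alpha_j>0$, with centers $\theta_j=\frac{\alpha_j+\beta_j}2$, and suppose that the points $x_j=e^{i\theta_j}$ satisfy $x_j=x_1\rho^{j-1}$, $\rho=e^{2\pi i/r}$, $j=1,\dots,r$. Consider the multi-index $\vec n=(n-r,1,\dots,1)\in\mathbb N^{r+1}$ and the weights on the unit circle $\omega^{(1)}(e^{i\theta})=1$, $\omega^{(j+1)}(e^{i\theta})=\mathbf 1_{E_j}(\theta)$, $j=1,\dots,r$, and assume that the type I vector for $\vec n$ exists and is unique. Then the type I linear form is $$\Psi_{\vec n}(z)=\frac1{r\,a_{n-1}}\left(\sum_{j=1}^rx_j^{n-1}\mathbf 1_{E_j}(\arg z)-\sum_{l=0}^{n-r-1}\left(\sum_{k=1}^ra_l\,x_k^{n-l-1}\right)z^l\right).$$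
   Context: Type I linear form: for weights $\omega^{(1)},\dots,\omega^{(r+1)}$ on $\mathbb T=\{|z|=1\}$ and multi-index $\vec n=(n_1,\dots,n_{r+1})$ with $n=\sum_jn_j$, the type I vector is a nonzero vector of polynomials $(\Lambda_1,\dots,\Lambda_{r+1})$ with $\deg\Lambda_j\le n_j-1$ such that $\Psi_{\vec n}(z)=\sum_j\Lambda_j(z)\omega^{(j)}(z)$ satisfies $\int_{\mathbb T}\Psi_{\vec n}(z)\overline{z^k}\frac{|dz|}{2\pi}=0$ for $k=0,\dots,n-2$ and $=1$ for $k=n-1$. Notation: $\arg z\in[0,2\pi)$ for $z\in\mathbb T$; $a_\ell=\frac1{\ell\pi}\sin\left(\frac{\ell\Delta}2\right)$ for $\ell\ne0$ and $a_0=\frac{\Delta}{2\pi}$. *)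

theory Defs
  imports "HOL-Analysis.Analysis"
begin

text \<open>The integral of \<open>f\<close> over the unit circle against \<open>|dz| / (2 \<pi>)\<close>.\<close>

definition circle_integral :: "(complex \<Rightarrow> complex) \<Rightarrow> complex" where
  "circle_integral f = (LINT t:{0..<2 * pi}|lborel. f (cis t)) / (2 * of_real pi)"

definition linear_form ::
    "nat \<Rightarrow> (nat \<Rightarrow> complex \<Rightarrow> real) \<Rightarrow> (nat \<Rightarrow> complex poly) \<Rightarrow> complex \<Rightarrow> complex" where
  "linear_form m \<omega> \<Lambda> z = (\<Sum>j=1..m. poly (\<Lambda> j) z * of_real (\<omega> j z))"

text \<open>
  Vectors with \<open>m\<close> components are functions on \<open>{1..m}\<close>, extended by \<open>undefined\<close> elsewhere, so
  that uniqueness of a vector is equality of functions. The zero polynomial has degree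
  \<open>-\<infinity>\<close> in the bound \<open>deg \<Lambda>\<^sub>j \<le> N\<^sub>j - 1\<close>; in particular \<open>N\<^sub>j = 0\<close> forces \<open>\<Lambda>\<^sub>j = 0\<close>.
\<close>

definition is_type_I_vector ::
    "nat \<Rightarrow> (nat \<Rightarrow> nat) \<Rightarrow> (nat \<Rightarrow> complex \<Rightarrow> real) \<Rightarrow> (nat \<Rightarrow> complex poly) \<Rightarrow> bool" where
  "is_type_I_vector m N \<omega> \<Lambda> \<longleftrightarrow>
     \<Lambda> \<in> extensional {1..m} \<and>
     (\<exists>j\<in>{1..m}. \<Lambda> j \<noteq> 0) \<and>
     (\<forall>j\<in>{1..m}. \<Lambda> j = 0 \<or> degree (\<Lambda> j) < N j) \<and>
     (let n = (\<Sum>j=1..m. N j) in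
       (\<forall>k<n - 1. circle_integral (\<lambda>z. linear_form m \<omega> \<Lambda> z * cnj (z ^ k)) = 0) \<and>
       circle_integral (\<lambda>z. linear_form m \<omega> \<Lambda> z * cnj (z ^ (n - 1))) = 1)"

text \<open>Meaningful only when the type I vector exists and is unique.\<close>

definition type_I_linear_form ::
    "nat \<Rightarrow> (nat \<Rightarrow> nat) \<Rightarrow> (nat \<Rightarrow> complex \<Rightarrow> real) \<Rightarrow> complex \<Rightarrow> complex" where
  "type_I_linear_form m N \<omega> = linear_form m \<omega> (THE \<Lambda>. is_type_I_vector m N \<omega> \<Lambda>)"

definition arc_coeff :: "real \<Rightarrow> nat \<Rightarrow> real" where
  "arc_coeff \<Delta> l = (if l = 0 then \<Delta> / (2 * pi) else sin (real l * \<Delta> / 2) / (real l * pi))"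

end

theory Submission
  imports Defs
begin

text \<open>
  Orthonormality of the powers of \<open>z\<close> turns the type I conditions into
  \<open>p\<^sub>k + a\<^sub>k \<Sum>\<^sub>j c\<^sub>j x\<^sub>j\<^bsup>-k\<^esup> = \<delta>\<^bsub>k,n-1\<^esub>\<close> for \<open>k < n\<close>, where \<open>p\<close> is the polynomial component
  and \<open>c\<^sub>j\<close> are the constant ones. For \<open>k = n - 1\<close> the existence of a solution forces
  \<open>a\<^bsub>n-1\<^esub> \<noteq> 0\<close>. The choice \<open>c\<^sub>j = x\<^sub>j\<^bsup>n-1\<^esup> / (r a\<^bsub>n-1\<^esub>)\<close> then satisfies the last \<open>r\<close> conditions,
  because the power sums \<open>\<Sum>\<^sub>j x\<^sub>j\<^sup>m\<close> vanish for \<open>0 < m < r\<close>, and the first \<open>n - r\<close> conditions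
  determine \<open>p\<close>. By uniqueness this is the type I vector.
\<close>

section \<open>Fourier coefficients of arcs and of the full circle\<close>

lemma has_bochner_integral_cis_Icc:
  fixes a b u :: real
  assumes "a \<le> b" and "u \<noteq> 0"
  shows "has_bochner_integral lborel (\<lambda>t. indicator {a..b} t *\<^sub>R cis (u * t))
           (of_real (2 * sin (u * (b - a) / 2) / u) * cis (u * ((a + b) / 2)))"
proof -
  define F where "F t = cis (u * t) / (\<i> * of_real u)" for t
  have "has_bochner_integral lborel (\<lambda>t. indicator {a..b} t *\<^sub>R cis (u * t)) (F b - F a)"
  proof (rule has_bochner_integral_FTC_Icc[OF assms(1)])
    show "(F has_vector_derivative cis (u * t)) (at t within {a..b})" for t
      unfolding F_def has_vector_derivative_def divide_inverse
      by (rule has_derivative_eq_rhs, rule has_derivative_mult_left, rule has_derivative_cis,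
          rule has_derivative_mult_right, rule has_derivative_ident)
        (use assms(2) in \<open>simp add: fun_eq_iff field_simps scaleR_conv_of_real\<close>)
    show "continuous_on {a..b} (\<lambda>t. cis (u * t))"
      by (intro continuous_intros)
  qed
  moreover have "F b - F a = of_real (2 * sin (u * (b - a) / 2) / u) * cis (u * ((a + b) / 2))"
  proof -
    \<comment> \<open>The endpoint phases are m - d and m + d. This makes the phase of the midpoint
      a factor and leaves the sine of the half-length: the first becomes a power of x_j, the second
      the sine in \<open>arc_coeff\<close>.\<close>
    define m d where "m = u * ((a + b) / 2)" and "d = u * (b - a) / 2"
    have "u * b = m + d" "u * a = m - d"
      by (simp_all add: m_def d_def field_simps)
    then have "F b - F a = cis m * (cis d - cis (- d)) / (\<i> * of_real u)"
      by (simp add: F_def diff_divide_distrib right_diff_distrib cis_mult)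
    also have "cis d - cis (- d) = 2 * \<i> * of_real (sin d)"
      by (simp add: complex_eq_iff)
    finally show ?thesis
      using assms(2) by (simp add: m_def d_def field_simps)
  qed
  ultimately show ?thesis
    by simp
qed

lemma has_bochner_integral_one_Icc:
  fixes a b :: real
  assumes "a \<le> b"
  shows "has_bochner_integral lborel (\<lambda>t. indicator {a..b} t *\<^sub>R (1 :: complex)) (of_real (b - a))"
proof -
  have "has_bochner_integral lborel (\<lambda>t. indicator {a..b} t *\<^sub>R (1 :: complex))
      (measure lborel {a..b} *\<^sub>R 1)"
    by (rule has_bochner_integral_indicator) (simp_all add: assms)
  then show ?thesis
    using assms by (simp add: scaleR_conv_of_real)
qed

text \<open>The conjugate power is an exponential of frequency -k. Since sin(u L / 2) / u is even in
  u, the sign disappears and 2 pi a_k remains. Frequency 0 has no such antiderivative, which is why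
  a_0 is defined separately.\<close>

lemma has_bochner_integral_arc_moment:
  assumes "a \<le> b"
  shows "has_bochner_integral lborel (\<lambda>t. indicator {a..b} t *\<^sub>R cnj (cis t ^ k))
           (2 * of_real pi * of_real (arc_coeff (b - a) k) * cnj (cis ((a + b) / 2)) ^ k)"
proof (cases "k = 0")
  case True
  then show ?thesis
    using has_bochner_integral_one_Icc[OF assms] by (simp add: arc_coeff_def)
next
  case False
  have c: "cnj (cis t ^ k) = cis (- real k * t)" for t
    by (simp only: cis_cnj complex_cnj_power Complex.DeMoivre mult_minus_left mult_minus_right)
  have "cnj (cis ((a + b) / 2)) ^ k = cis (- real k * ((a + b) / 2))"
    using c[of "(a + b) / 2"] by simp
  then show ?thesis
    using has_bochner_integral_cis_Icc[OF assms, of "- real k"] False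
    unfolding c by (simp add: arc_coeff_def)
qed

lemma has_bochner_integral_circle_orthogonal:
  "has_bochner_integral lborel (\<lambda>t. indicator {0..<2 * pi} t *\<^sub>R (cis t ^ l * cnj (cis t ^ k)))
     (if l = k then 2 * of_real pi else 0)"
proof -
  define u where "u = real l - real k"
  have c: "cis t ^ l * cnj (cis t ^ k) = cis (u * t)" for t
    by (simp only: cis_cnj complex_cnj_power Complex.DeMoivre cis_mult u_def
        diff_conv_add_uminus distrib_right mult_minus_left mult_minus_right)
  have "has_bochner_integral lborel (\<lambda>t. indicator {0..2 * pi} t *\<^sub>R cis (u * t))
      (if l = k then 2 * of_real pi else 0)"
  proof (cases "l = k")
    case True
    then show ?thesis
      using has_bochner_integral_one_Icc[of 0 "2 * pi"] by (simp add: u_def)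
  next
    case False
    have "sin (u * (2 * pi - 0) / 2) = 0"
      unfolding u_def sin_zero_iff_int2
      by (intro exI[of _ "int l - int k"]) simp
    then show ?thesis
      using has_bochner_integral_cis_Icc[of 0 "2 * pi" u] False by (simp add: u_def)
  qed
  \<comment> \<open>The formula for intervals concerns closed ones; the half-open range of the
    circle differs from [0, 2 pi] only in the null set {2 pi}.\<close>
  moreover have "AE t in lborel. indicator {0..2 * pi} t *\<^sub>R cis (u * t)
      = indicator {0..<2 * pi} t *\<^sub>R cis (u * t)"
    using AE_lborel_singleton[of "2 * pi"]
    by eventually_elim (auto simp: indicator_def)
  moreover have [measurable]: "(\<lambda>t. cis (u * t)) \<in> borel_measurable borel"
    by (intro borel_measurable_continuous_onI continuous_intros)
  ultimately show ?thesis
    unfolding c by (elim has_bochner_integral_cong_AE[THEN iffD1, rotated 3]) simp_all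
qed

section \<open>Moments of a linear form, and power sums of roots of unity\<close>

lemma sum_atLeast1_Suc_atMost:
  "(\<Sum>j=1..r + 1. f j) = f 1 + (\<Sum>j=1..r. f (j + 1))"
  for f :: "nat \<Rightarrow> 'a :: comm_monoid_add"
  using sum.atLeast_Suc_atMost[of 1 "r + 1" f] sum.shift_bounds_cl_Suc_ivl[of f 1 r] by simp

text \<open>This reduces the integral conditions to linear equations in the coefficients:
  orthogonality extracts one coefficient of the polynomial component, and each arc contributes its
  Fourier coefficient. The factor 2 pi of both cancels against the normalization.\<close>

lemma circle_integral_arc_form:
  fixes \<omega> :: "nat \<Rightarrow> complex \<Rightarrow> real"
  assumes arcs: "\<And>j. j \<in> {1..r} \<Longrightarrow> {\<alpha> j..\<beta> j} \<subseteq> {0..<2 * pi}"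
    and len: "\<And>j. j \<in> {1..r} \<Longrightarrow> \<beta> j - \<alpha> j = \<Delta>" and "\<Delta> > 0"
    and w1: "\<And>t. t \<in> {0..<2 * pi} \<Longrightarrow> \<omega> 1 (cis t) = 1"
    and w: "\<And>j t. j \<in> {1..r} \<Longrightarrow> t \<in> {0..<2 * pi} \<Longrightarrow>
              \<omega> (j + 1) (cis t) = indicator {\<alpha> j..\<beta> j} t"
    and const: "\<And>j. j \<in> {1..r} \<Longrightarrow> \<Lambda> (j + 1) = [:c j:]"
  shows "circle_integral (\<lambda>z. linear_form (r + 1) \<omega> \<Lambda> z * cnj (z ^ k)) =
           coeff (\<Lambda> 1) k +
           of_real (arc_coeff \<Delta> k) * (\<Sum>j=1..r. c j * cnj (cis ((\<alpha> j + \<beta> j) / 2)) ^ k)"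
proof -
  let ?y = "\<lambda>j. cnj (cis ((\<alpha> j + \<beta> j) / 2)) ^ k"
  have split: "indicator {0..<2 * pi} t *\<^sub>R (linear_form (r + 1) \<omega> \<Lambda> (cis t) * cnj (cis t ^ k)) =
      (\<Sum>l\<le>degree (\<Lambda> 1). coeff (\<Lambda> 1) l *
         (indicator {0..<2 * pi} t *\<^sub>R (cis t ^ l * cnj (cis t ^ k)))) +
      (\<Sum>j=1..r. c j * (indicator {\<alpha> j..\<beta> j} t *\<^sub>R cnj (cis t ^ k)))" for t
  proof (cases "t \<in> {0..<2 * pi}")
    case True
    have "linear_form (r + 1) \<omega> \<Lambda> (cis t) =
        poly (\<Lambda> 1) (cis t) + (\<Sum>j=1..r. c j * of_real (indicator {\<alpha> j..\<beta> j} t))"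
      unfolding linear_form_def sum_atLeast1_Suc_atMost
      using w[OF _ True] w1[OF True] const by simp
    then show ?thesis
      using True
      by (simp add: poly_altdef distrib_right sum_distrib_right mult.assoc scaleR_conv_of_real)
  next
    \<comment> \<open>Outside [0, 2 pi) the arc terms carry no cut-off of their own; they vanish
      because the arcs lie in that range.\<close>
    case False
    then have "(\<Sum>j=1..r. c j * (indicator {\<alpha> j..\<beta> j} t *\<^sub>R cnj (cis t ^ k))) = 0"
      using arcs by (intro sum.neutral ballI) (fastforce simp: indicator_def)
    with False show ?thesis
      by simp
  qed
  have "has_bochner_integral lborel
      (\<lambda>t. indicator {0..<2 * pi} t *\<^sub>R (linear_form (r + 1) \<omega> \<Lambda> (cis t) * cnj (cis t ^ k)))
      ((\<Sum>l\<le>degree (\<Lambda> 1). coeff (\<Lambda> 1) l * (if l = k then 2 * of_real pi else 0)) +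
       (\<Sum>j=1..r. c j * (2 * of_real pi * of_real (arc_coeff \<Delta> k) * ?y j)))"
    unfolding split
  proof (intro has_bochner_integral_add has_bochner_integral_sum has_bochner_integral_mult_right)
    fix j assume "j \<in> {1..r}"
    then show "has_bochner_integral lborel (\<lambda>t. indicator {\<alpha> j..\<beta> j} t *\<^sub>R cnj (cis t ^ k))
        (2 * of_real pi * of_real (arc_coeff \<Delta> k) * ?y j)"
      using has_bochner_integral_arc_moment[of "\<alpha> j" "\<beta> j" k] len[of j] \<open>\<Delta> > 0\<close> by simp
  qed (rule has_bochner_integral_circle_orthogonal)
  \<comment> \<open>For k above the degree no index matches, and
    \<open>coeff (\<Lambda> 1) k\<close> is 0 as well.\<close>
  also have "(\<Sum>l\<le>degree (\<Lambda> 1). coeff (\<Lambda> 1) l * (if l = k then 2 * of_real pi else 0)) =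
      2 * of_real pi * coeff (\<Lambda> 1) k"
    by (simp add: if_distrib[of "(*) _"] coeff_eq_0 cong: if_cong)
  also have "(\<Sum>j=1..r. c j * (2 * of_real pi * of_real (arc_coeff \<Delta> k) * ?y j)) =
      2 * of_real pi * (of_real (arc_coeff \<Delta> k) * (\<Sum>j=1..r. c j * ?y j))"
    by (simp add: sum_distrib_left mult_ac)
  finally show ?thesis
    unfolding circle_integral_def set_lebesgue_integral_def
    by (simp add: has_bochner_integral_integral_eq distrib_left[symmetric])
qed

text \<open>A geometric sum of r terms whose ratio has r-th power 1; the ratio itself is not 1, as r
  does not divide m.\<close>

lemma sum_powers_roots_unity_eq_0:
  assumes "0 < m" and "m < r"
  shows "(\<Sum>j=1..r. (exp (2 * of_real pi * \<i> / of_nat r) ^ (j - 1)) ^ m) = (0 :: complex)"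
proof -
  let ?\<rho> = "exp (2 * of_real pi * \<i> / of_nat r) :: complex"
  have "?\<rho> ^ m = exp (2 * of_real pi * \<i> * of_nat m / of_nat r)"
    by (simp add: exp_of_nat_mult[symmetric] mult_ac)
  moreover have "\<dots> \<noteq> 1"
    using complex_root_unity_eq_1[of r m] assms by (auto dest: dvd_imp_le)
  ultimately have ne: "?\<rho> ^ m \<noteq> 1"
    by simp
  have "?\<rho> ^ r = 1"
    using assms by (simp add: exp_of_nat_mult[symmetric])
  then have "(?\<rho> ^ m) ^ r = 1"
    by (metis power_mult mult.commute power_one)
  have "(\<Sum>j=1..r. (?\<rho> ^ (j - 1)) ^ m) = (\<Sum>j<r. (?\<rho> ^ m) ^ j)"
    by (rule sum.reindex_bij_witness[of _ "\<lambda>j. j + 1" "\<lambda>j. j - 1"])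
      (auto simp: power_mult[symmetric] mult.commute)
  also have "\<dots> = 0"
    using ne \<open>(?\<rho> ^ m) ^ r = 1\<close> by (simp add: geometric_sum)
  finally show ?thesis .
qed

theorem corollary3p13:
  fixes r n :: nat
    and \<alpha> \<beta> \<theta> :: "nat \<Rightarrow> real"
    and \<Delta> :: real
    and x :: "nat \<Rightarrow> complex"
    and N :: "nat \<Rightarrow> nat"
    and \<omega> :: "nat \<Rightarrow> complex \<Rightarrow> real"
  assumes "r \<ge> 1" and "n > r"
    and "\<And>j. j \<in> {1..r} \<Longrightarrow> {\<alpha> j..\<beta> j} \<subseteq> {0..<2 * pi}"
    and "disjoint_family_on (\<lambda>j. {\<alpha> j..\<beta> j}) {1..r}"
    and "\<Delta> > 0" and "\<And>j. j \<in> {1..r} \<Longrightarrow> \<beta> j - \<alpha> j = \<Delta>"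
    and "\<And>j. j \<in> {1..r} \<Longrightarrow> \<theta> j = (\<alpha> j + \<beta> j) / 2"
    and "\<And>j. j \<in> {1..r} \<Longrightarrow> x j = exp (\<i> * of_real (\<theta> j))"
    and "\<And>j. j \<in> {1..r} \<Longrightarrow> x j = x 1 * exp (2 * of_real pi * \<i> / of_nat r) ^ (j - 1)"
    and "N 1 = n - r" and "\<And>j. j \<in> {1..r} \<Longrightarrow> N (j + 1) = 1"
    and "\<And>t. t \<in> {0..<2 * pi} \<Longrightarrow> \<omega> 1 (exp (\<i> * of_real t)) = 1"
    and "\<And>j t. j \<in> {1..r} \<Longrightarrow> t \<in> {0..<2 * pi} \<Longrightarrow>
           \<omega> (j + 1) (exp (\<i> * of_real t)) = indicator {\<alpha> j..\<beta> j} t"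
    and "\<exists>!\<Lambda>. is_type_I_vector (r + 1) N \<omega> \<Lambda>"
  shows "\<forall>z\<in>sphere 0 1. type_I_linear_form (r + 1) N \<omega> z =
           1 / (of_nat r * of_real (arc_coeff \<Delta> (n - 1))) *
           ((\<Sum>j=1..r. x j ^ (n - 1) * indicator {\<alpha> j..\<beta> j} (Arg2pi z)) -
            (\<Sum>l=0..n - r - 1. (\<Sum>k=1..r. of_real (arc_coeff \<Delta> l) * x k ^ (n - l - 1)) * z ^ l))"
proof -
  define a where "a l = (of_real (arc_coeff \<Delta> l) :: complex)" for l
  have cis: "exp (\<i> * of_real t) = cis t" for t
    by (simp add: cis_conv_exp)
  have x: "x j = cis ((\<alpha> j + \<beta> j) / 2)" if "j \<in> {1..r}" for j
    unfolding assms(8)[OF that] assms(7)[OF that] by (rule cis)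
  have cnj_x: "x j * cnj (x j) = 1" if "j \<in> {1..r}" for j
    using x[OF that] by (simp add: cis_cnj cis_mult)
  have x_nz: "x j \<noteq> 0" if "j \<in> {1..r}" for j
    using x[OF that] by simp
  have N_sum: "(\<Sum>j=1..r + 1. N j) = n"
    unfolding sum_atLeast1_Suc_atMost using assms(1,2,10,11) by simp
  have components: "j = 1 \<or> (\<exists>i\<in>{1..r}. j = i + 1)" if "j \<in> {1..r + 1}" for j
    using that by (cases "j = 1") (auto intro!: bexI[of _ "j - 1"])
  have moment: "circle_integral (\<lambda>z. linear_form (r + 1) \<omega> \<Lambda> z * cnj (z ^ k)) =
      coeff (\<Lambda> 1) k + a k * (\<Sum>j=1..r. c j * cnj (x j) ^ k)"
    if "\<And>j. j \<in> {1..r} \<Longrightarrow> \<Lambda> (j + 1) = [:c j:]" for \<Lambda> c k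
    using circle_integral_arc_form[where r = r and c = c and \<Lambda> = \<Lambda> and \<alpha> = \<alpha> and \<beta> = \<beta> and \<Delta> = \<Delta> and \<omega> = \<omega>,
      OF assms(3,6,5) assms(12,13)[unfolded cis] that] by (simp add: x a_def)

  have a_nz: "a (n - 1) \<noteq> 0"
  proof
    assume "a (n - 1) = 0"
    obtain \<Lambda> where \<Lambda>: "is_type_I_vector (r + 1) N \<omega> \<Lambda>"
      using assms(14) by blast
    have deg: "\<Lambda> j = 0 \<or> degree (\<Lambda> j) < N j" if "j \<in> {1..r + 1}" for j
      using \<Lambda> that unfolding is_type_I_vector_def by blast
    have "\<Lambda> (j + 1) = [:coeff (\<Lambda> (j + 1)) 0:]" if "j \<in> {1..r}" for j
    proof -
      have "degree (\<Lambda> (j + 1)) = 0"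
        using deg[of "j + 1"] assms(11)[OF that] that by auto
      then show ?thesis
        by (auto elim!: degree_eq_zeroE)
    qed
    \<comment> \<open>The degree is below n - r, which is at most n - 1 because r is positive. So
      the moment of order n - 1 sees only the arcs and is a multiple of a_(n-1); it cannot be 1 if
      that is 0.\<close>
    moreover have "coeff (\<Lambda> 1) (n - 1) = 0"
      using deg[of 1] assms(1,2,10) by (auto intro: coeff_eq_0)
    ultimately have "circle_integral (\<lambda>z. linear_form (r + 1) \<omega> \<Lambda> z * cnj (z ^ (n - 1))) = 0"
      using moment[of \<Lambda> "\<lambda>j. coeff (\<Lambda> (j + 1)) 0" "n - 1"] \<open>a (n - 1) = 0\<close> by simp
    then show False
      using \<Lambda> by (simp only: is_type_I_vector_def N_sum Let_def) simp
  qed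

  define K where "K = 1 / (of_nat r * a (n - 1))"
  have K_nz: "K \<noteq> 0"
    using a_nz assms(1) by (simp add: K_def)
  \<comment> \<open>Each coefficient of p is chosen to cancel the contribution of the arcs to the
    moment of the same order.\<close>
  define p where
    "p = (\<Sum>l=0..n - r - 1. monom (- K * (\<Sum>k=1..r. a l * x k ^ (n - l - 1))) l)"
  define \<Lambda> where "\<Lambda> = (\<lambda>j. if j = 1 then p
      else if j \<in> {1..r + 1} then [:K * x (j - 1) ^ (n - 1):] else undefined)"
  have \<Lambda>_const: "\<Lambda> (j + 1) = [:K * x j ^ (n - 1):]" if "j \<in> {1..r}" for j
    using that by (simp add: \<Lambda>_def)
  have coeff_p: "coeff p k = (if k < n - r then - K * (\<Sum>j=1..r. a k * x j ^ (n - k - 1)) else 0)" for k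
    using assms(2) by (auto simp: p_def coeff_sum)
  have p_deg: "degree p < n - r"
    unfolding p_def using assms(2)
    by (intro degree_sum_less) (auto intro: le_less_trans[OF degree_monom_le])
  \<comment> \<open>Conjugation inverts x_j, so the arc part of moment k becomes a multiple of the
    power sum of exponent n - k - 1.\<close>
  have "x j ^ (n - 1) * cnj (x j) ^ k = x j ^ (n - k - 1)" if "j \<in> {1..r}" "k < n" for j k
  proof -
    have "n - 1 = (n - k - 1) + k"
      using that by simp
    then have "x j ^ (n - 1) * cnj (x j) ^ k = x j ^ (n - k - 1) * (x j * cnj (x j)) ^ k"
      by (metis mult.assoc power_add power_mult_distrib)
    then show ?thesis
      by (simp only: cnj_x[OF that(1)] power_one mult_1_right)
  qed
  then have \<Lambda>_moment: "circle_integral (\<lambda>z. linear_form (r + 1) \<omega> \<Lambda> z * cnj (z ^ k)) =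
      coeff p k + K * a k * (\<Sum>j=1..r. x j ^ (n - k - 1))" if "k < n" for k
    using moment[of \<Lambda> "\<lambda>j. K * x j ^ (n - 1)" k, OF \<Lambda>_const] that
    by (simp add: \<Lambda>_def sum_distrib_left mult_ac)
  have power_sum: "(\<Sum>j=1..r. x j ^ m) = 0" if "0 < m" "m < r" for m
  proof -
    have "(\<Sum>j=1..r. x j ^ m) =
        (\<Sum>j=1..r. x 1 ^ m * (exp (2 * of_real pi * \<i> / of_nat r) ^ (j - 1)) ^ m)"
      using assms(9) by (intro sum.cong refl) (metis power_mult_distrib)
    then show ?thesis
      using sum_powers_roots_unity_eq_0[OF that] by (simp only: sum_distrib_left[symmetric]) simp
  qed
  have "is_type_I_vector (r + 1) N \<omega> \<Lambda>"
    unfolding is_type_I_vector_def N_sum Let_def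
  proof (intro conjI ballI allI impI)
    show "\<Lambda> \<in> extensional {1..r + 1}"
      by (auto simp: extensional_def \<Lambda>_def)
    show "\<exists>j\<in>{1..r + 1}. \<Lambda> j \<noteq> 0"
      using \<Lambda>_const[of 1] x_nz[of 1] K_nz assms(1) by (intro bexI[of _ "1 + 1"]) auto
    show "\<Lambda> j = 0 \<or> degree (\<Lambda> j) < N j" if "j \<in> {1..r + 1}" for j
      using components[OF that] p_deg assms(10,11) \<Lambda>_const by (auto simp: \<Lambda>_def)
    show "circle_integral (\<lambda>z. linear_form (r + 1) \<omega> \<Lambda> z * cnj (z ^ k)) = 0" if "k < n - 1" for k
    proof (cases "k < n - r")
      case True
      then show ?thesis
        using \<Lambda>_moment[of k] that by (simp add: coeff_p sum_distrib_left sum_negf mult_ac)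
    next
      \<comment> \<open>Here n - r \<le> k < n - 1: p has no coefficient of this order, and the
        exponent n - k - 1 lies strictly between 0 and r.\<close>
      case False
      then show ?thesis
        using \<Lambda>_moment[of k] that power_sum[of "n - k - 1"] by (simp add: coeff_p)
    qed
    \<comment> \<open>Now the exponent is 0 and the power sum is r, which fixes the value of
      \<open>K\<close>.\<close>
    show "circle_integral (\<lambda>z. linear_form (r + 1) \<omega> \<Lambda> z * cnj (z ^ (n - 1))) = 1"
      using \<Lambda>_moment[of "n - 1"] assms(1,2) a_nz by (simp add: coeff_p K_def)
  qed
  then have the_\<Lambda>: "(THE \<Lambda>. is_type_I_vector (r + 1) N \<omega> \<Lambda>) = \<Lambda>"
    by (rule the1_equality[OF assms(14)])

  show ?thesis
  proof
    fix z :: complex assume "z \<in> sphere 0 1"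
    \<comment> \<open>The weights are prescribed only at points e^(it) with t in [0, 2 pi), so z is
      first written in this form.\<close>
    then have z: "z = exp (\<i> * of_real (Arg2pi z))" and t: "Arg2pi z \<in> {0..<2 * pi}"
      using complex_norm_eq_1_exp[of z] Arg2pi[of z] by auto
    have w1: "\<omega> 1 z = 1"
      using assms(12)[OF t] z by simp
    have w: "\<omega> (j + 1) z = indicator {\<alpha> j..\<beta> j} (Arg2pi z)" if "j \<in> {1..r}" for j
      using assms(13)[OF that t] z by simp
    have p_z: "poly p z = - K * (\<Sum>l=0..n - r - 1. (\<Sum>k=1..r. a l * x k ^ (n - l - 1)) * z ^ l)"
      by (simp add: p_def poly_sum poly_monom sum_distrib_left[of K "\<lambda>l. _ l * z ^ l"] mult.assoc sum_negf)
    have "linear_form (r + 1) \<omega> \<Lambda> z =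
        poly p z + (\<Sum>j=1..r. K * x j ^ (n - 1) * of_real (indicator {\<alpha> j..\<beta> j} (Arg2pi z)))"
      unfolding linear_form_def sum_atLeast1_Suc_atMost
      using w1 w \<Lambda>_const by (simp add: \<Lambda>_def)
    also have "(\<Sum>j=1..r. K * x j ^ (n - 1) * of_real (indicator {\<alpha> j..\<beta> j} (Arg2pi z))) =
        K * (\<Sum>j=1..r. x j ^ (n - 1) * indicator {\<alpha> j..\<beta> j} (Arg2pi z))"
      unfolding sum_distrib_left by (intro sum.cong refl) (simp add: indicator_def)
    finally show "type_I_linear_form (r + 1) N \<omega> z =
           1 / (of_nat r * of_real (arc_coeff \<Delta> (n - 1))) *
           ((\<Sum>j=1..r. x j ^ (n - 1) * indicator {\<alpha> j..\<beta> j} (Arg2pi z)) -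
            (\<Sum>l=0..n - r - 1. (\<Sum>k=1..r. of_real (arc_coeff \<Delta> l) * x k ^ (n - l - 1)) * z ^ l))"
      unfolding type_I_linear_form_def the_\<Lambda> p_z a_def[symmetric] K_def[symmetric]
      by (simp only: right_diff_distrib) simp
  qed
qed

end
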